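(* Let $n \geq 1$ be a positive integer. There exists a $\chi_g$-lower-game-vertex-critical graph $G$ such that $\chi_g(G)-\chi_g(G-x)=n$ for every vertex $x \in V(G)$.
   Context: All graphs are simple, undirected and finite. The coloring game on a graph $G$ with color set $\{1,\ldots,k\}$ is played by Alice and Bob. Alice moves first and the players alternate turns; in each turn the player colors a previously uncolored vertex with a color from $\{1,\ldots,k\}$ different from the colors already given to its neighbors. If at some point there is an uncolored vertex having all colors $1,\ldots,k$ in its neighborhood, Bob wins; otherwise, if all vertices get colored, Alice wins. The game chromatic number $\chi_g(G)$ is the minimum $k$ for which Alice has a winning strategy on $G$. For $x\in V(G)$, $G-x$ is the graph obtained from $G$ by deleting $x$ and all edges incident with $x$. A graph $G$ is $\chi_g$-lower-game-vertex-critical if $\chi_g(G-x)<\chi_g(G)$ for every $x\in V(G)$. *)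

theory Defs
  imports "Graph_Theory.Digraph"
begin

text \<open>
  A finite simple undirected graph is a \<^locale>\<open>graph\<close>: a finite symmetric digraph without loops and
  multiple arcs, each undirected edge being represented by its two orientations. The null graph
  satisfies \<^locale>\<open>graph\<close> as well.
\<close>

text \<open>
  The history of a play lists its moves, the most recent one first. Thus \<open>map_of h\<close> is the partial
  coloring reached, and Alice is to move iff the length of \<open>h\<close> is even.
\<close>

type_synonym 'a history = "('a \<times> nat) list"

type_synonym 'a strategy = "'a history \<Rightarrow> 'a \<times> nat"

definition uncolored :: "('a, 'b) pre_digraph \<Rightarrow> 'a history \<Rightarrow> 'a set" where
  "uncolored G h = {v \<in> verts G. map_of h v = None}"

definition neighbor_colors :: "('a, 'b) pre_digraph \<Rightarrow> 'a history \<Rightarrow> 'a \<Rightarrow> nat set" where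
  "neighbor_colors G h v = {c. \<exists>u. v \<rightarrow>\<^bsub>G\<^esub> u \<and> map_of h u = Some c}"

definition legal_move :: "('a, 'b) pre_digraph \<Rightarrow> nat \<Rightarrow> 'a history \<Rightarrow> 'a \<times> nat \<Rightarrow> bool" where
  "legal_move G k h m \<longleftrightarrow>
     fst m \<in> uncolored G h \<and> snd m \<in> {1..k} \<and> snd m \<notin> neighbor_colors G h (fst m)"

definition bob_won :: "('a, 'b) pre_digraph \<Rightarrow> nat \<Rightarrow> 'a history \<Rightarrow> bool" where
  "bob_won G k h \<longleftrightarrow> (\<exists>v \<in> uncolored G h. {1..k} \<subseteq> neighbor_colors G h v)"

definition game_over :: "('a, 'b) pre_digraph \<Rightarrow> nat \<Rightarrow> 'a history \<Rightarrow> bool" where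
  "game_over G k h \<longleftrightarrow> bob_won G k h \<or> uncolored G h = {}"

text \<open>The histories that can arise when Alice follows the strategy \<open>\<sigma>\<close> and Bob plays arbitrarily.\<close>

inductive consistent_play ::
  "('a, 'b) pre_digraph \<Rightarrow> nat \<Rightarrow> 'a strategy \<Rightarrow> 'a history \<Rightarrow> bool" for G k \<sigma> where
  start: "consistent_play G k \<sigma> []"
| alice: "consistent_play G k \<sigma> h \<Longrightarrow> \<not> game_over G k h \<Longrightarrow> even (length h) \<Longrightarrow>
    legal_move G k h (\<sigma> h) \<Longrightarrow> consistent_play G k \<sigma> (\<sigma> h # h)"
| bob: "consistent_play G k \<sigma> h \<Longrightarrow> \<not> game_over G k h \<Longrightarrow> odd (length h) \<Longrightarrow>
    legal_move G k h m \<Longrightarrow> consistent_play G k \<sigma> (m # h)"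

text \<open>
  On a finite graph every play ends after finitely many moves, and as long as the game is not over
  the player to move has a legal move. Hence Alice wins all plays following \<open>\<sigma>\<close> iff \<open>\<sigma>\<close> always
  prescribes legal moves and no play following \<open>\<sigma>\<close> is ever won by Bob.
\<close>

definition winning_strategy :: "('a, 'b) pre_digraph \<Rightarrow> nat \<Rightarrow> 'a strategy \<Rightarrow> bool" where
  "winning_strategy G k \<sigma> \<longleftrightarrow> (\<forall>h. consistent_play G k \<sigma> h \<longrightarrow>
     \<not> bob_won G k h \<and>
     (\<not> game_over G k h \<and> even (length h) \<longrightarrow> legal_move G k h (\<sigma> h)))"

text \<open>
  The set of \<open>k\<close> below is nonempty for every finite graph, as it contains the number of vertices.
  The null graph has game chromatic number \<open>0\<close>.
\<close>

definition game_chromatic_number :: "('a, 'b) pre_digraph \<Rightarrow> nat" ("\<chi>\<^sub>g") where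
  "\<chi>\<^sub>g G = (LEAST k. \<exists>\<sigma>. winning_strategy G k \<sigma>)"

definition lower_game_vertex_critical :: "('a, 'b) pre_digraph \<Rightarrow> bool" where
  "lower_game_vertex_critical G \<longleftrightarrow>
     (\<forall>x \<in> verts G. \<chi>\<^sub>g (pre_digraph.del_vert G x) < \<chi>\<^sub>g G)"

end

theory Submission
  imports Defs
begin

text \<open>
  The witness is the crown graph on \<open>m = n + 3\<close> matched pairs, that is \<open>K\<^bsub>m,m\<^esub>\<close> minus a perfect
  matching. Bob forces \<open>m\<close> colors by always copying Alice's color to the vertex matched with the one
  she has just colored: every pair uses up a new color. If a vertex \<open>x\<close> is deleted, Alice starts with
  the vertex matched with \<open>x\<close>, which blocks its color on the whole side of \<open>x\<close>. She answers
  Bob's first move on the matched vertex so that another color gets blocked on the other side.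
  From then on each side always has an admissible color, so three colors suffice; two do not,
  because Bob can color two neighbors of an uncolored vertex differently.
\<close>

section \<open>The coloring game\<close>

lemma uncolored_Cons: "uncolored G (m # h) = uncolored G h - {fst m}"
  by (cases m) (auto simp: uncolored_def)

lemma neighbor_colors_Nil [simp]: "neighbor_colors G [] v = {}"
  by (simp add: neighbor_colors_def)

text \<open>A legal move colors a fresh vertex, so the new head of the list shadows no earlier entry
  under \<open>map_of\<close>.\<close>

lemma neighbor_colors_Cons:
  assumes "legal_move G k h m"
  shows "neighbor_colors G (m # h) v =
    neighbor_colors G h v \<union> (if v \<rightarrow>\<^bsub>G\<^esub> fst m then {snd m} else {})"
proof -
  have "map_of h (fst m) = None"
    using assms by (auto simp: legal_move_def uncolored_def)
  then have "map_of (m # h) u = Some c \<longleftrightarrow> map_of h u = Some c \<or> u = fst m \<and> c = snd m" for u c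
    by (cases m) auto
  then show ?thesis by (auto simp: neighbor_colors_def)
qed

text \<open>Alice can choose, by Hilbert choice, any legal move that restores \<open>Inv\<close>;
  every play consistent with this strategy then stays in \<open>Inv\<close>.\<close>

lemma winning_strategy_of_invariant:
  assumes start: "Inv []"
    and safe: "\<And>h. Inv h \<Longrightarrow> \<not> bob_won G k h"
    and alice: "\<And>h. Inv h \<Longrightarrow> even (length h) \<Longrightarrow> uncolored G h \<noteq> {} \<Longrightarrow>
      \<exists>m. legal_move G k h m \<and> Inv (m # h)"
    and bob: "\<And>h m. Inv h \<Longrightarrow> odd (length h) \<Longrightarrow> legal_move G k h m \<Longrightarrow> Inv (m # h)"
  shows "\<exists>\<sigma>. winning_strategy G k \<sigma>"
proof -
  define \<sigma> where "\<sigma> h = (SOME m. legal_move G k h m \<and> Inv (m # h))" for h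
  have \<sigma>: "legal_move G k h (\<sigma> h) \<and> Inv (\<sigma> h # h)"
    if "Inv h" "even (length h)" "\<not> game_over G k h" for h
    using someI_ex[OF alice[of h]] that by (simp add: \<sigma>_def game_over_def)
  have "Inv h" if "consistent_play G k \<sigma> h" for h
    using that by induction (use start \<sigma> bob in auto)
  then show ?thesis
    using \<sigma> safe by (auto simp: winning_strategy_def)
qed

text \<open>In this form, as long as Bob has not won, every uncolored vertex offers Alice a legal
  move.\<close>

lemma bob_won_iff:
  "bob_won G k h \<longleftrightarrow> (\<exists>v \<in> uncolored G h. \<forall>c. \<not> legal_move G k h (v, c))"
  by (simp add: bob_won_def legal_move_def subset_iff Bex_def) blast

text \<open>Monotonicity of winning in the number of colors is not presupposed, so every
  \<open>l < k\<close> is excluded separately.\<close>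

lemma game_chromatic_number_eqI:
  assumes "\<exists>\<sigma>. winning_strategy G k \<sigma>"
    and "\<And>l \<sigma>. l < k \<Longrightarrow> \<not> winning_strategy G l \<sigma>"
  shows "\<chi>\<^sub>g G = k"
  unfolding game_chromatic_number_def using assms
  by (intro Least_equality) (auto simp: not_less[symmetric])

lemma finite_neighbor_colors: "finite (neighbor_colors G h v)"
proof -
  have "neighbor_colors G h v \<subseteq> set (map snd h)"
    by (force simp: neighbor_colors_def dest: map_of_SomeD)
  then show ?thesis by (rule finite_subset) simp
qed

lemma card_neighbor_colors_le_length: "card (neighbor_colors G h v) \<le> length h"
proof -
  have "neighbor_colors G h v \<subseteq> set (map snd h)"
    by (force simp: neighbor_colors_def dest: map_of_SomeD)
  then have "card (neighbor_colors G h v) \<le> card (set (map snd h))"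
    by (intro card_mono) auto
  also have "\<dots> \<le> length h"
    by (metis card_length length_map)
  finally show ?thesis .
qed

lemma not_bob_won_if_few_neighbor_colors:
  assumes "\<And>v. v \<in> uncolored G h \<Longrightarrow> card (neighbor_colors G h v) < k"
  shows "\<not> bob_won G k h"
proof
  assume "bob_won G k h"
  then obtain v where "v \<in> uncolored G h" "{1..k} \<subseteq> neighbor_colors G h v"
    by (auto simp: bob_won_def)
  with assms[of v] card_mono[OF finite_neighbor_colors, of "{1..k}" G h v] show False by simp
qed

text \<open>Each neighbor contributes at most one color, so no vertex ever sees all \<open>k\<close>
  colors and Alice may move arbitrarily.\<close>

lemma winning_strategy_if_degree_less:
  assumes "\<And>v. v \<in> verts G \<Longrightarrow> finite {u. v \<rightarrow>\<^bsub>G\<^esub> u} \<and> card {u. v \<rightarrow>\<^bsub>G\<^esub> u} < k"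
  shows "\<exists>\<sigma>. winning_strategy G k \<sigma>"
proof -
  have not_won: "\<not> bob_won G k h" for h
  proof (rule not_bob_won_if_few_neighbor_colors)
    fix v assume v: "v \<in> uncolored G h"
    then have fin: "finite {u. v \<rightarrow>\<^bsub>G\<^esub> u}" and less: "card {u. v \<rightarrow>\<^bsub>G\<^esub> u} < k"
      using assms by (auto simp: uncolored_def)
    have "neighbor_colors G h v \<subseteq> (\<lambda>u. the (map_of h u)) ` {u. v \<rightarrow>\<^bsub>G\<^esub> u}"
      by (force simp: neighbor_colors_def)
    then have "card (neighbor_colors G h v) \<le> card {u. v \<rightarrow>\<^bsub>G\<^esub> u}"
      using surj_card_le[OF fin] by blast
    with less show "card (neighbor_colors G h v) < k" by simp
  qed
  show ?thesis
  proof (rule winning_strategy_of_invariant[where Inv = "\<lambda>_. True"])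
    fix h assume "uncolored G h \<noteq> {}"
    then show "\<exists>m. legal_move G k h m \<and> True"
      using not_won[of h] by (auto simp: bob_won_iff)
  qed (use not_won in auto)
qed

text \<open>Wherever Alice opens, Bob gives the other color to a non-adjacent \<open>w\<close> that
  shares an uncolored neighbor \<open>u\<close> with her vertex; \<open>u\<close> then sees both
  colors.\<close>

lemma no_winning_strategy_le_2:
  assumes "verts G \<noteq> {}" and "k \<le> 2"
    and fork: "\<And>v. v \<in> verts G \<Longrightarrow> \<exists>w \<in> verts G. \<exists>u \<in> verts G.
      w \<noteq> v \<and> u \<noteq> v \<and> u \<noteq> w \<and> u \<rightarrow>\<^bsub>G\<^esub> v \<and> u \<rightarrow>\<^bsub>G\<^esub> w \<and> \<not> w \<rightarrow>\<^bsub>G\<^esub> v"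
  shows "\<not> winning_strategy G k \<sigma>"
proof
  assume win: "winning_strategy G k \<sigma>"
  obtain v c where vc: "\<sigma> [] = (v, c)" by fastforce
  have play0: "consistent_play G k \<sigma> []" by (rule start)
  have "\<not> game_over G k []"
    using win play0 assms(1) by (auto simp: winning_strategy_def game_over_def uncolored_def)
  with win play0 have leg: "legal_move G k [] (v, c)"
    using vc by (auto simp: winning_strategy_def)
  with \<open>\<not> game_over G k []\<close> play0 have play1: "consistent_play G k \<sigma> [(v, c)]"
    using alice[of G k \<sigma> "[]"] vc by simp
  from leg have v: "v \<in> verts G" and c: "c \<in> {1..k}"
    by (auto simp: legal_move_def uncolored_def)
  then obtain w u where w: "w \<in> verts G" "w \<noteq> v" "\<not> w \<rightarrow>\<^bsub>G\<^esub> v"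
    and u: "u \<in> verts G" "u \<noteq> v" "u \<noteq> w" "u \<rightarrow>\<^bsub>G\<^esub> v" "u \<rightarrow>\<^bsub>G\<^esub> w"
    using fork by blast
  have over1: "\<not> game_over G k [(v, c)]"
    using win play1 w by (auto simp: winning_strategy_def game_over_def uncolored_def)
  \<comment> \<open>With a single color Alice's own opening already blocks \<open>u\<close>;
    \<open>k = 0\<close> is excluded because her opening color exists.\<close>
  have "k \<noteq> 1"
  proof
    assume "k = 1"
    with c u have "bob_won G k [(v, c)]"
      by (auto simp: bob_won_def uncolored_def neighbor_colors_def intro!: bexI[of _ u])
    with win play1 show False by (auto simp: winning_strategy_def)
  qed
  with c \<open>k \<le> 2\<close> have k: "k = 2" and c12: "c = 1 \<or> c = 2" by auto
  \<comment> \<open>The other one of the colors 1 and 2.\<close>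
  define d where "d = 3 - c"
  from c12 have d: "d \<in> {1..k}" "{1..k} \<subseteq> {c, d}" using k by (auto simp: d_def)
  have "legal_move G k [(v, c)] (w, d)"
    using w d by (auto simp: legal_move_def uncolored_def neighbor_colors_def)
  with play1 over1 have "consistent_play G k \<sigma> [(w, d), (v, c)]"
    using bob[of G k \<sigma> "[(v, c)]"] by simp
  moreover have "bob_won G k [(w, d), (v, c)]"
    using u w d by (auto simp: bob_won_def uncolored_def neighbor_colors_def intro!: bexI[of _ u])
  ultimately show False using win by (auto simp: winning_strategy_def)
qed

section \<open>Reserved colors\<close>

text \<open>The second conjunct makes the first permanent: vertices outside \<open>S\<close> that
  are still uncolored are barred from \<open>c\<close>.\<close>

definition reserved :: "('a, 'b) pre_digraph \<Rightarrow> 'a history \<Rightarrow> 'a set \<Rightarrow> nat \<Rightarrow> bool" where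
  "reserved G h S c \<longleftrightarrow> (\<forall>v \<in> verts G - S. map_of h v \<noteq> Some c) \<and>
     (\<forall>v \<in> uncolored G h - S. c \<in> neighbor_colors G h v)"

text \<open>A legal move outside \<open>S\<close> cannot use \<open>c\<close>, since its vertex sees
  \<open>c\<close>; and colors once seen remain seen.\<close>

lemma reserved_Cons:
  assumes "reserved G h S c" and "legal_move G k h m"
  shows "reserved G (m # h) S c"
  using assms unfolding reserved_def neighbor_colors_Cons[OF assms(2)] uncolored_Cons
  by (cases m) (auto simp: legal_move_def)

text \<open>All neighbors of a vertex of \<open>S\<close> lie outside \<open>S\<close>, where
  \<open>c\<close> never occurs, so \<open>c\<close> stays available on \<open>S\<close>; likewise
  \<open>d\<close> on \<open>T\<close>.\<close>

lemma not_bob_won_if_reserved: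
  assumes "reserved G h S c" "reserved G h T d" "c \<in> {1..k}" "d \<in> {1..k}" "verts G = S \<union> T"
    and "\<And>u v. u \<rightarrow>\<^bsub>G\<^esub> v \<Longrightarrow> u \<in> S \<Longrightarrow> v \<in> verts G - S"
    and "\<And>u v. u \<rightarrow>\<^bsub>G\<^esub> v \<Longrightarrow> u \<in> T \<Longrightarrow> v \<in> verts G - T"
  shows "\<not> bob_won G k h"
proof -
  have "c \<notin> neighbor_colors G h v" if "v \<in> S" for v
    using assms(1,6) that unfolding neighbor_colors_def reserved_def by blast
  moreover have "d \<notin> neighbor_colors G h v" if "v \<in> T" for v
    using assms(2,7) that unfolding neighbor_colors_def reserved_def by blast
  ultimately show ?thesis
    using assms(3-5) unfolding bob_won_def uncolored_def by blast
qed

section \<open>Crown graphs\<close>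

text \<open>The two sides are the even and the odd numbers; the removed matching joins \<open>2 i\<close> and \<open>2 i + 1\<close>.\<close>

definition partner :: "nat \<Rightarrow> nat" where
  "partner v = (if even v then Suc v else v - 1)"

lemma even_partner [simp]: "even (partner v) \<longleftrightarrow> odd v"
  by (auto simp: partner_def)

lemma partner_partner [simp]: "partner (partner v) = v"
  by (auto simp: partner_def)

lemma partner_neq [simp]: "partner v \<noteq> v" "v \<noteq> partner v"
  by (auto simp: partner_def elim: oddE)

lemma partner_eq_iff: "partner u = v \<longleftrightarrow> u = partner v"
  by auto

lemma partner_less_iff [simp]: "partner v < 2 * m \<longleftrightarrow> v < 2 * m"
  by (auto simp: partner_def elim!: evenE oddE)

definition crown :: "nat \<Rightarrow> (nat, nat \<times> nat) pre_digraph" where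
  "crown m = \<lparr>verts = {..<2 * m},
     arcs = {(u, v). u < 2 * m \<and> v < 2 * m \<and> even u \<noteq> even v \<and> v \<noteq> partner u},
     tail = fst, head = snd\<rparr>"

lemma verts_crown [simp]: "verts (crown m) = {..<2 * m}"
  by (simp add: crown_def)

lemma adj_crown_iff:
  "u \<rightarrow>\<^bsub>crown m\<^esub> v \<longleftrightarrow> u < 2 * m \<and> v < 2 * m \<and> even u \<noteq> even v \<and> v \<noteq> partner u"
  by (auto simp: crown_def arcs_ends_def arc_to_ends_def)

lemma graph_crown: "graph (crown m)"
proof
  show "finite (verts (crown m))" by simp
  have "arcs (crown m) \<subseteq> {..<2 * m} \<times> {..<2 * m}" by (auto simp: crown_def)
  then show "finite (arcs (crown m))" by (rule finite_subset) simp
  show "symmetric (crown m)"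
    by (auto simp: symmetric_def adj_crown_iff intro!: symI)
qed (auto simp: crown_def arc_to_ends_def)

lemma verts_del_crown [simp]: "verts (pre_digraph.del_vert (crown m) x) = {..<2 * m} - {x}"
  by (simp add: pre_digraph.verts_del_vert)

lemma adj_del_crown_iff:
  "u \<rightarrow>\<^bsub>pre_digraph.del_vert (crown m) x\<^esub> v \<longleftrightarrow> u \<rightarrow>\<^bsub>crown m\<^esub> v \<and> u \<noteq> x \<and> v \<noteq> x"
  by (auto simp: crown_def arcs_ends_def arc_to_ends_def pre_digraph.del_vert_def)

lemma card_parity: "card {u. u < 2 * m \<and> even u = b} = m"
proof (induction m)
  case (Suc m)
  have "{u. u < 2 * Suc m \<and> even u = b} =
    insert (if b then 2 * m else Suc (2 * m)) {u. u < 2 * m \<and> even u = b}"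
    by (cases b) (auto simp: less_Suc_eq)
  with Suc show ?case by simp
qed simp

section \<open>The game on the full crown graph\<close>

lemma degree_crown:
  assumes "v < 2 * m"
  shows "card {u. v \<rightarrow>\<^bsub>crown m\<^esub> u} < m"
proof -
  \<comment> \<open>The whole opposite side except the partner, hence \<open>m - 1\<close>
    neighbors.\<close>
  have "{u. v \<rightarrow>\<^bsub>crown m\<^esub> u} = {u. u < 2 * m \<and> even u = odd v} - {partner v}"
    using assms by (auto simp: adj_crown_iff)
  moreover have "partner v \<in> {u. u < 2 * m \<and> even u = odd v}"
    using assms by simp
  ultimately show ?thesis
    using card_parity[of m "odd v"] assms by (simp add: card_Diff_singleton del: mem_Collect_eq)
qed

lemma winning_strategy_crown: "\<exists>\<sigma>. winning_strategy (crown m) m \<sigma>"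
proof (rule winning_strategy_if_degree_less)
  fix v assume "v \<in> verts (crown m)"
  moreover have "{u. v \<rightarrow>\<^bsub>crown m\<^esub> u} \<subseteq> {..<2 * m}" by (auto simp: adj_crown_iff)
  ultimately show "finite {u. v \<rightarrow>\<^bsub>crown m\<^esub> u} \<and> card {u. v \<rightarrow>\<^bsub>crown m\<^esub> u} < m"
    using degree_crown[of v m] by (auto intro: finite_subset)
qed

text \<open>A used color sits on both ends of some pair other than that of \<open>v\<close>, and one
  of these ends is adjacent to \<open>v\<close>.\<close>

lemma neighbor_colors_mirrored:
  assumes mirror: "\<And>u. map_of h (partner u) = map_of h u"
    and dom: "dom (map_of h) \<subseteq> {..<2 * m}"
    and v: "v < 2 * m" "map_of h v = None"
  shows "neighbor_colors (crown m) h v = ran (map_of h)"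
proof (rule set_eqI, rule iffI)
  fix c assume "c \<in> ran (map_of h)"
  then obtain u where u: "map_of h u = Some c" by (auto simp: ran_def)
  with mirror[of v] v have "u \<noteq> v" "u \<noteq> partner v" by auto
  moreover have "u < 2 * m" using u dom by auto
  \<comment> \<open>Of \<open>u\<close> and its partner, take the one on the side opposite to
    \<open>v\<close>.\<close>
  ultimately have "v \<rightarrow>\<^bsub>crown m\<^esub> (if even u = even v then partner u else u)"
    using v by (auto simp: adj_crown_iff partner_eq_iff)
  then show "c \<in> neighbor_colors (crown m) h v"
    using u mirror[of u] by (auto simp: neighbor_colors_def split: if_splits)
qed (auto simp: neighbor_colors_def ran_def)

text \<open>Bob's copying makes each round use up one new color. After \<open>k\<close> rounds all
  colors are used, and since \<open>k < m\<close> some vertex is still uncolored and sees them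
  all.\<close>

lemma no_winning_strategy_crown:
  assumes "k < m"
  shows "\<not> winning_strategy (crown m) k \<sigma>"
proof
  let ?G = "crown m"
  assume win: "winning_strategy ?G k \<sigma>"
  have free: "\<exists>v. v < 2 * m \<and> map_of h v = None" if "length h < 2 * m" for h :: "nat history"
  proof (rule ccontr)
    assume "\<not> ?thesis"
    then have "{..<2 * m} \<subseteq> dom (map_of h)" by (auto simp: dom_def)
    then have "2 * m \<le> card (dom (map_of h))"
      using card_mono[OF finite_dom_map_of] by fastforce
    also have "\<dots> \<le> length h"
      by (metis card_length dom_map_of_conv_image_fst length_map list.set_map)
    finally show False using that by simp
  qed
  \<comment> \<open>The position after \<open>t\<close> full rounds, with Alice to move: mirrored,
    and with exactly \<open>t\<close> colors used.\<close>
  have play: "\<exists>h. consistent_play ?G k \<sigma> h \<and> length h = 2 * t \<and> card (ran (map_of h)) = t \<and>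
      ran (map_of h) \<subseteq> {1..k} \<and> dom (map_of h) \<subseteq> {..<2 * m} \<and>
      (\<forall>u. map_of h (partner u) = map_of h u)" if "t \<le> k" for t
    using that
  proof (induction t)
    case 0
    show ?case by (intro exI[of _ "[]"]) (auto intro: start)
  next
    case (Suc t)
    then obtain h where h: "consistent_play ?G k \<sigma> h" "length h = 2 * t"
        "card (ran (map_of h)) = t" "ran (map_of h) \<subseteq> {1..k}" "dom (map_of h) \<subseteq> {..<2 * m}"
      and mirror: "\<And>u. map_of h (partner u) = map_of h u"
      by auto
    obtain v c where vc: "\<sigma> h = (v, c)" by fastforce
    have over: "\<not> game_over ?G k h"
      using win h(1) free[of h] h(2) Suc.prems assms
      by (auto simp: winning_strategy_def game_over_def uncolored_def)
    then have leg: "legal_move ?G k h (v, c)"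
      using win h(1,2) vc by (auto simp: winning_strategy_def)
    then have v: "v < 2 * m" "map_of h v = None" and c: "c \<in> {1..k}"
      by (auto simp: legal_move_def uncolored_def)
    have pv: "partner v < 2 * m" "map_of h (partner v) = None"
      using v mirror by auto
    \<comment> \<open>In a mirrored position \<open>v\<close> sees every used color, so legality
      forces a new one.\<close>
    have new: "c \<notin> ran (map_of h)"
      using leg neighbor_colors_mirrored[OF mirror h(5) v] by (simp add: legal_move_def)
    have play1: "consistent_play ?G k \<sigma> ((v, c) # h)"
      using alice[OF h(1) over] h(2) leg vc by simp
    have over1: "\<not> game_over ?G k ((v, c) # h)"
      using win play1 pv
      by (auto simp: winning_strategy_def game_over_def uncolored_def intro!: exI[of _ "partner v"])
    \<comment> \<open>Partners are not adjacent, so Alice's move does not bar \<open>c\<close> from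
      \<open>partner v\<close>.\<close>
    have "legal_move ?G k ((v, c) # h) (partner v, c)"
      using pv c new neighbor_colors_mirrored[OF mirror h(5) pv]
      by (auto simp: legal_move_def uncolored_def neighbor_colors_Cons[OF leg] adj_crown_iff)
    then have "consistent_play ?G k \<sigma> ((partner v, c) # (v, c) # h)"
      using bob[OF play1 over1] h(2) by simp
    moreover have "ran (map_of ((partner v, c) # (v, c) # h)) = insert c (ran (map_of h))"
      using v pv by simp
    moreover have "card (insert c (ran (map_of h))) = Suc t"
      using h(3,4) new finite_subset by fastforce
    moreover have "dom (map_of ((partner v, c) # (v, c) # h)) \<subseteq> {..<2 * m}"
      using h(5) v(1) pv(1) by (auto simp: dom_def)
    moreover have "\<forall>u. map_of ((partner v, c) # (v, c) # h) (partner u) =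
        map_of ((partner v, c) # (v, c) # h) u"
      using mirror by (simp add: partner_eq_iff)
    ultimately show ?case
      using h(2,4) c by (intro exI[of _ "(partner v, c) # (v, c) # h"]) (simp del: map_of.simps)
  qed
  then obtain h where h: "consistent_play ?G k \<sigma> h" "length h = 2 * k"
      "card (ran (map_of h)) = k" "ran (map_of h) \<subseteq> {1..k}" "dom (map_of h) \<subseteq> {..<2 * m}"
    and mirror: "\<And>u. map_of h (partner u) = map_of h u"
    using play[OF order_refl] by blast
  obtain v where v: "v < 2 * m" "map_of h v = None"
    using free[of h] h(2) assms by auto
  have "ran (map_of h) = {1..k}"
    using h(3,4) by (intro card_subset_eq) auto
  then have "bob_won ?G k h"
    using v neighbor_colors_mirrored[OF mirror h(5) v]
    by (auto simp: bob_won_def uncolored_def)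
  with win h(1) show False by (auto simp: winning_strategy_def)
qed

lemma game_chromatic_number_crown: "\<chi>\<^sub>g (crown m) = m"
  by (intro game_chromatic_number_eqI winning_strategy_crown no_winning_strategy_crown)

section \<open>Crown graphs with a vertex deleted\<close>

text \<open>Within her first two moves Alice reserves one color for each side; afterwards every
  legal move is good.\<close>

lemma winning_strategy_del_crown:
  assumes x: "x < 2 * k"
  shows "\<exists>\<sigma>. winning_strategy (pre_digraph.del_vert (crown k) x) 3 \<sigma>"
proof -
  let ?G = "pre_digraph.del_vert (crown k) x"
  define S where "S = {v \<in> verts ?G. even v = even x}"
  define T where "T = {v \<in> verts ?G. even v = odd x}"
  define y where "y = partner x"
  \<comment> \<open>Color 1 is kept for \<open>T\<close>, the side of \<open>y\<close>, and some
    \<open>p\<close> for \<open>S\<close>, the side of the deleted \<open>x\<close>.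
    \<open>Inv\<close> lists the opening positions up to Bob's first move, before security is
    guaranteed.\<close>
  define secure where "secure h \<longleftrightarrow> reserved ?G h T 1 \<and> (\<exists>p \<in> {1..3}. reserved ?G h S p)" for h
  define Inv where "Inv h \<longleftrightarrow> h = [] \<or> h = [(y, 1)] \<or>
    (\<exists>m. h = [m, (y, 1)] \<and> legal_move ?G 3 [(y, 1)] m) \<or> secure h" for h
  have y: "y < 2 * k" "y \<noteq> x" "even y = odd x" "partner y = x"
    using x by (auto simp: y_def)
  have ST: "verts ?G = S \<union> T" by (auto simp: S_def T_def)
  have safe: "\<not> bob_won ?G 3 h" if "Inv h" for h
  proof (cases "secure h")
    case True
    then obtain p where p: "p \<in> {1..3}" "reserved ?G h S p" "reserved ?G h T 1"
      by (auto simp: secure_def)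
    show ?thesis
      by (rule not_bob_won_if_reserved[OF p(2,3,1) _ ST])
        (auto simp: S_def T_def adj_del_crown_iff adj_crown_iff)
  next
    case False
    \<comment> \<open>At most two moves have been made, too few to show three colors to any
      vertex.\<close>
    with that have "length h < 3" by (auto simp: Inv_def)
    then show ?thesis
      by (intro not_bob_won_if_few_neighbor_colors)
        (auto intro: le_less_trans[OF card_neighbor_colors_le_length])
  qed
  have y1: "legal_move ?G 3 [] (y, 1)"
    using y by (auto simp: legal_move_def uncolored_def)
  \<comment> \<open>The only vertex of the opposite side not adjacent to \<open>y\<close> was the
    deleted \<open>x\<close>, so all of \<open>S\<close> already sees color 1.\<close>
  have resT: "reserved ?G [(y, 1)] T 1"
    using y by (auto simp: reserved_def T_def uncolored_def neighbor_colors_def adj_del_crown_iff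
        adj_crown_iff partner_eq_iff y_def)
  have secure_Cons: "secure (m # h)" if "secure h" "legal_move ?G 3 h m" for h m
    using that(1) reserved_Cons[OF _ that(2)] unfolding secure_def by blast
  have answer: "\<exists>n. legal_move ?G 3 [m, (y, 1)] n \<and> secure (n # [m, (y, 1)])"
    if m: "legal_move ?G 3 [(y, 1)] m" for m
  proof -
    obtain u c where m_eq: "m = (u, c)" by fastforce
    have u: "u < 2 * k" "u \<noteq> x" "u \<noteq> y" "c \<in> {1..3}" "even u = even x \<Longrightarrow> c \<noteq> 1"
      using m y x unfolding m_eq y_def
      by (auto simp: legal_move_def uncolored_def neighbor_colors_def adj_del_crown_iff adj_crown_iff
          partner_eq_iff split: if_splits)
    \<comment> \<open>As \<open>u\<close> is neither \<open>x\<close> nor \<open>y\<close>, its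
      partner exists and is uncolored.\<close>
    then have pu: "partner u < 2 * k" "partner u \<noteq> y" "partner u \<noteq> x" "partner u \<noteq> u"
      by (auto simp: y_def partner_eq_iff)
    show ?thesis
    proof (cases "even u = even x")
      \<comment> \<open>Bob played in \<open>S\<close>, so \<open>c\<close> is not 1. Coloring the
        only non-neighbor of \<open>u\<close> in \<open>T\<close> with 1 leaves every uncolored
        vertex of \<open>T\<close> seeing \<open>c\<close>: Bob's own color becomes reserved for
        \<open>S\<close>.\<close>
      case True
      let ?h = "[(partner u, 1), m, (y, 1)]"
      have "\<not> partner u \<rightarrow>\<^bsub>?G\<^esub> u" "\<not> partner u \<rightarrow>\<^bsub>?G\<^esub> y"
        using True y(3) by (simp_all add: adj_del_crown_iff adj_crown_iff)
      then have leg: "legal_move ?G 3 [m, (y, 1)] (partner u, 1)"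
        using pu unfolding m_eq
        by (auto simp: legal_move_def uncolored_def neighbor_colors_def split: if_splits)
      have adj: "v \<rightarrow>\<^bsub>?G\<^esub> u" if "v \<in> uncolored ?G ?h - S" for v
        using that u(1,2) True
        by (auto simp: adj_del_crown_iff adj_crown_iff uncolored_def S_def partner_eq_iff
            split: if_splits)
      have "reserved ?G ?h S c"
        unfolding reserved_def
      proof (intro conjI ballI)
        show "map_of ?h v \<noteq> Some c" if "v \<in> verts ?G - S" for v
          using that u True by (auto simp: m_eq S_def)
        show "c \<in> neighbor_colors ?G ?h v" if "v \<in> uncolored ?G ?h - S" for v
          using adj[OF that] pu(4) unfolding m_eq
          by (auto simp: neighbor_colors_def intro!: exI[of _ u])
      qed
      with reserved_Cons[OF reserved_Cons[OF resT m] leg] u(4) have "secure ?h"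
        by (auto simp: secure_def)
      with leg show ?thesis by blast
    next
      case False
      \<comment> \<open>Bob played in \<open>T\<close>. Alice needs a color other than 1, which
        \<open>partner u\<close> sees at \<open>y\<close>, and other than \<open>c\<close>, which
        \<open>u\<close> carries in \<open>T\<close>. All vertices of \<open>T\<close> except the
        colored \<open>u\<close> are adjacent to \<open>partner u\<close>, so \<open>p\<close>
        becomes reserved for \<open>S\<close>.\<close>
      define p :: nat where "p = (if c = 2 then 3 else 2)"
      have p: "p \<in> {1..3}" "p \<noteq> c" "p \<noteq> 1" by (auto simp: p_def)
      let ?h = "[(partner u, p), m, (y, 1)]"
      have leg: "legal_move ?G 3 [m, (y, 1)] (partner u, p)"
        using pu p unfolding m_eq
        by (auto simp: legal_move_def uncolored_def neighbor_colors_def split: if_splits)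
      have adj: "v \<rightarrow>\<^bsub>?G\<^esub> partner u" if "v \<in> uncolored ?G ?h - S" for v
        using that pu False
        by (auto simp: adj_del_crown_iff adj_crown_iff uncolored_def S_def m_eq partner_eq_iff
            split: if_splits)
      have "reserved ?G ?h S p"
        unfolding reserved_def
      proof (intro conjI ballI)
        show "map_of ?h v \<noteq> Some p" if "v \<in> verts ?G - S" for v
          using that p False by (auto simp: m_eq S_def)
        show "p \<in> neighbor_colors ?G ?h v" if "v \<in> uncolored ?G ?h - S" for v
          using adj[OF that] by (auto simp: neighbor_colors_def intro!: exI[of _ "partner u"])
      qed
      with reserved_Cons[OF reserved_Cons[OF resT m] leg] p(1) have "secure ?h"
        by (auto simp: secure_def)
      with leg show ?thesis by blast
    qed
  qed
  show ?thesis
  proof (rule winning_strategy_of_invariant[where Inv = Inv])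
    show "Inv []" by (simp add: Inv_def)
    show "\<not> bob_won ?G 3 h" if "Inv h" for h using safe[OF that] .
    show "\<exists>m. legal_move ?G 3 h m \<and> Inv (m # h)"
      if "Inv h" "even (length h)" "uncolored ?G h \<noteq> {}" for h
    proof -
      have "\<exists>m. legal_move ?G 3 h m \<and> Inv (m # h)" if "secure h"
      proof -
        obtain m where "legal_move ?G 3 h m"
          using safe[OF \<open>Inv h\<close>] \<open>uncolored ?G h \<noteq> {}\<close> unfolding bob_won_iff by blast
        with secure_Cons[OF that] show ?thesis unfolding Inv_def by blast
      qed
      moreover have "\<exists>m. legal_move ?G 3 h m \<and> Inv (m # h)" if "h = []"
        using y1 that by (auto simp: Inv_def)
      moreover have "\<exists>m. legal_move ?G 3 h m \<and> Inv (m # h)"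
        if "h = [m, (y, 1)]" "legal_move ?G 3 [(y, 1)] m" for m
        using answer[OF that(2)] that(1) by (auto simp: Inv_def)
      ultimately show ?thesis
        using \<open>Inv h\<close> \<open>even (length h)\<close> by (auto simp: Inv_def)
    qed
    show "Inv (m # h)" if "Inv h" "odd (length h)" "legal_move ?G 3 h m" for h m
      \<comment> \<open>Odd length leaves only the position after Alice's opening and the secure
        ones.\<close>
      using that secure_Cons[OF _ that(3)] by (auto simp: Inv_def)
  qed
qed

lemma no_winning_strategy_del_crown:
  assumes "4 \<le> m" "k < 3" "x < 2 * m"
  shows "\<not> winning_strategy (pre_digraph.del_vert (crown m) x) k \<sigma>"
proof (rule no_winning_strategy_le_2)
  have "partner x \<in> verts (pre_digraph.del_vert (crown m) x)"
    using assms by simp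
  then show "verts (pre_digraph.del_vert (crown m) x) \<noteq> {}" by blast
  show "k \<le> 2" using assms by simp
  fix v assume v: "v \<in> verts (pre_digraph.del_vert (crown m) x)"
  \<comment> \<open>A side of the crown has at least four vertices, so three can be avoided.\<close>
  have avoid: "\<exists>w. w < 2 * m \<and> even w = b \<and> w \<notin> {x, y, z}" for b y z
  proof -
    have "card {x, y, z} \<le> 3"
      by (auto simp: card_insert_if)
    then have "card {x, y, z} < card {w. w < 2 * m \<and> even w = b}"
      using assms(1) card_parity[of m b] by simp
    then have "\<not> {w. w < 2 * m \<and> even w = b} \<subseteq> {x, y, z}"
      by (meson card_mono finite.emptyI finite.insertI not_le)
    then show ?thesis by blast
  qed
  \<comment> \<open>\<open>w\<close> lies on the side of \<open>v\<close>, hence is not adjacent to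
    it; \<open>u\<close> on the other side avoids both partners, hence is adjacent to both.\<close>
  obtain w where w: "w < 2 * m" "even w = even v" "w \<notin> {x, v, v}"
    using avoid by blast
  obtain u where u: "u < 2 * m" "even u = odd v" "u \<notin> {x, partner v, partner w}"
    using avoid by blast
  show "\<exists>w \<in> verts (pre_digraph.del_vert (crown m) x).
    \<exists>u \<in> verts (pre_digraph.del_vert (crown m) x). w \<noteq> v \<and> u \<noteq> v \<and> u \<noteq> w \<and>
      u \<rightarrow>\<^bsub>pre_digraph.del_vert (crown m) x\<^esub> v \<and> u \<rightarrow>\<^bsub>pre_digraph.del_vert (crown m) x\<^esub> w \<and>
      \<not> w \<rightarrow>\<^bsub>pre_digraph.del_vert (crown m) x\<^esub> v"
    using u v w
    by (intro bexI[of _ w] bexI[of _ u]) (auto simp: adj_del_crown_iff adj_crown_iff)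
qed

lemma game_chromatic_number_del_crown:
  assumes "4 \<le> m" "x < 2 * m"
  shows "\<chi>\<^sub>g (pre_digraph.del_vert (crown m) x) = 3"
  using assms by (intro game_chromatic_number_eqI winning_strategy_del_crown no_winning_strategy_del_crown)

theorem proposition6:
  fixes n :: nat
  assumes "n \<ge> 1"
  shows "\<exists>G :: (nat, nat \<times> nat) pre_digraph.
    graph G \<and> verts G \<noteq> {} \<and> lower_game_vertex_critical G \<and>
    (\<forall>x \<in> verts G. int (\<chi>\<^sub>g G) - int (\<chi>\<^sub>g (pre_digraph.del_vert G x)) = int n)"
  \<comment> \<open>The difference is \<open>(n + 3) - 3\<close>, and \<open>n \<ge> 1\<close> gives
    the at least four pairs required for the value 3 after deletion.\<close>
  using assms
  by (intro exI[of _ "crown (n + 3)"])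
    (auto simp: graph_crown lower_game_vertex_critical_def game_chromatic_number_crown
      game_chromatic_number_del_crown lessThan_empty_iff)

end
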